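(* Let $([0,1],\bigvee,*,1)$ be a left-continuous $t$-norm and let $(\Delta,\bigvee,*,e)$ be the associated quantale of distance distributions, with bottom element $0$. Let $\varphi:\Delta\to\Delta$ be a lower-semicontinuous function satisfying $\varphi(u)>u$ for all $u\in\Delta$ with $0<u<e$ (i.e. $\varphi(u)\ge u$ and $\varphi(u)\ne u$), and $\varphi(e)=e$. Suppose that $f:X\to X$ is a function on a Cauchy-complete generalized probabilistic metric space $(X,d,* )$ such that, writing $d(x,y,-)\in\Delta$ for $t\mapsto d(x,y,t)$, one has $d(fx,fy,t)\ge\varphi(d(x,y,-))(t)$ for all $x,y\in X$ and all $t\in[0,\infty]$. If there exists an $x\in X$ such that $d(x,fx,-)\neq 0\neq d(fx,x,-)$ in $\Delta$, then $f$ has a fixpoint.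
   Context: A left-continuous $t$-norm is a commutative monoid operation $*$ on $[0,1]$ with unit $1$ that distributes over arbitrary suprema in each variable. The set of distance distributions is $\Delta=\{g:[0,\infty]\to[0,1]\mid g(t)=\bigvee_{s<t}g(s)\text{ for all }t\}$, ordered pointwise, with pointwise suprema, with product $(g*h)(t)=\bigvee_{r+s=t}g(r)*h(s)$, and with unit $e$ given by $e(0)=0$ and $e(t)=1$ for $t>0$. It is a commutative quantale (a complete lattice with a monoid structure distributing over arbitrary suprema in each variable), $e$ is its top element, and its bottom $0$ is the constant function $0$. A generalized probabilistic metric space $(X,d,* )$ (a category enriched in $\Delta$) is a set $X$ with a map $d:X\times X\times[0,\infty]\to[0,1]$ such that $d(x,y,t)=\bigvee_{s<t}d(x,y,s)$; $d(x,x,t)=1$ for $t>0$; and $d(x,y,r)*d(y,z,s)\le d(x,z,r+s)$. No finiteness, symmetry or separatedness is required. $(X,d,* )$ is Cauchy-complete if every left adjoint presheaf is representable: whenever $\phi,\psi:X\to\Delta$ satisfy $d(y',y,-)*\phi(y)\le\phi(y')$ and $\psi(y)*d(y,y',-)\le\psi(y')$ for all $y,y'$, together with $e\le\bigvee_{y\in X}\psi(y)*\phi(y)$ and $\phi(y)*\psi(y')\le d(y,y',-)$ for all $y,y'$, there is $u\in X$ with $\phi(y)=d(y,u,-)$ for all $y$. A fixpoint of $f$ is a $u\in X$ with $d(fu,u,-)=e=d(u,fu,-)$. A function $\varphi:L\to M$ between complete lattices is lower-semicontinuous if for every net $(t_i)_{i\in I}$ in $L$ (a family indexed by a directed poset $I$),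 $\varphi(\bigvee_i\bigwedge_{j\ge i}t_j)\le\bigvee_i\bigwedge_{j\ge i}\varphi(t_j)$. *)

theory Defs
  imports "HOL-Analysis.Analysis"
begin

typedef unit_interval = "{0..1::real}"
  by auto

lemma Rep_unit_interval_bounds: "0 \<le> Rep_unit_interval a" "Rep_unit_interval a \<le> 1"
  using Rep_unit_interval[of a] by auto

instantiation unit_interval :: complete_linorder
begin

definition "a \<le> b \<longleftrightarrow> Rep_unit_interval a \<le> Rep_unit_interval b"
definition "a < b \<longleftrightarrow> Rep_unit_interval a < Rep_unit_interval b"
definition "bot = Abs_unit_interval 0"
definition "top = Abs_unit_interval 1"
definition "inf a b = (if a \<le> b then a else (b :: unit_interval))"
definition "sup a b = (if a \<le> b then b else (a :: unit_interval))"
definition "Sup A = (if A = {} then Abs_unit_interval 0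
  else Abs_unit_interval (SUP a\<in>A. Rep_unit_interval a))"
definition "Inf A = (if A = {} then Abs_unit_interval 1
  else Abs_unit_interval (INF a\<in>A. Rep_unit_interval a))"

instance
proof
  have bdd: "bdd_above (Rep_unit_interval ` A)" "bdd_below (Rep_unit_interval ` A)" for A
    using Rep_unit_interval_bounds by (auto intro!: bdd_aboveI bdd_belowI)
  have S: "Rep_unit_interval (Sup A) = (SUP a\<in>A. Rep_unit_interval a)" if "A \<noteq> {}" for A
  proof -
    from that obtain a where "a \<in> A" by auto
    then have "0 \<le> (SUP a\<in>A. Rep_unit_interval a)"
      by (intro order_trans[OF Rep_unit_interval_bounds(1)[of a]] cSUP_upper bdd)
    moreover have "(SUP a\<in>A. Rep_unit_interval a) \<le> 1"
      using that by (intro cSUP_least Rep_unit_interval_bounds)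
    ultimately show ?thesis using that
      by (simp add: Sup_unit_interval_def Abs_unit_interval_inverse)
  qed
  have I: "Rep_unit_interval (Inf A) = (INF a\<in>A. Rep_unit_interval a)" if "A \<noteq> {}" for A
  proof -
    from that obtain a where "a \<in> A" by auto
    then have "(INF a\<in>A. Rep_unit_interval a) \<le> 1"
      by (intro order_trans[OF _ Rep_unit_interval_bounds(2)[of a]] cINF_lower bdd)
    moreover have "0 \<le> (INF a\<in>A. Rep_unit_interval a)"
      using that by (intro cINF_greatest Rep_unit_interval_bounds)
    ultimately show ?thesis using that
      by (simp add: Inf_unit_interval_def Abs_unit_interval_inverse)
  qed
  fix x y z :: unit_interval and A :: "unit_interval set"
  show "(x < y) = (x \<le> y \<and> \<not> y \<le> x)" "x \<le> x" "x \<le> y \<Longrightarrow> y \<le> z \<Longrightarrow> x \<le> z"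
    "x \<le> y \<Longrightarrow> y \<le> x \<Longrightarrow> x = y" "x \<le> y \<or> y \<le> x"
    "inf x y \<le> x" "inf x y \<le> y" "x \<le> y \<Longrightarrow> x \<le> z \<Longrightarrow> x \<le> inf y z"
    "x \<le> sup x y" "y \<le> sup x y" "y \<le> x \<Longrightarrow> z \<le> x \<Longrightarrow> sup y z \<le> x"
    by (auto simp: less_eq_unit_interval_def less_unit_interval_def inf_unit_interval_def
        sup_unit_interval_def Rep_unit_interval_inject)
  show "x \<in> A \<Longrightarrow> Inf A \<le> x"
    unfolding less_eq_unit_interval_def by (subst I) (auto intro: cINF_lower bdd)
  show "x \<in> A \<Longrightarrow> x \<le> Sup A"
    unfolding less_eq_unit_interval_def by (subst S) (auto intro: cSUP_upper bdd)
  show "(\<And>x. x \<in> A \<Longrightarrow> z \<le> x) \<Longrightarrow> z \<le> Inf A"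
  proof (cases "A = {}")
    case False
    then show "(\<And>x. x \<in> A \<Longrightarrow> z \<le> x) \<Longrightarrow> z \<le> Inf A"
      unfolding less_eq_unit_interval_def by (subst I) (auto intro: cINF_greatest)
  qed (simp add: less_eq_unit_interval_def Inf_unit_interval_def Abs_unit_interval_inverse
      Rep_unit_interval_bounds)
  show "(\<And>x. x \<in> A \<Longrightarrow> x \<le> z) \<Longrightarrow> Sup A \<le> z"
  proof (cases "A = {}")
    case False
    then show "(\<And>x. x \<in> A \<Longrightarrow> x \<le> z) \<Longrightarrow> Sup A \<le> z"
      unfolding less_eq_unit_interval_def by (subst S) (auto intro: cSUP_least)
  qed (simp add: less_eq_unit_interval_def Sup_unit_interval_def Abs_unit_interval_inverse
      Rep_unit_interval_bounds)
  show "Inf {} = (top :: unit_interval)" "Sup {} = (bot :: unit_interval)"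
    by (simp_all add: Inf_unit_interval_def Sup_unit_interval_def top_unit_interval_def
        bot_unit_interval_def)
qed

end

lemma Rep_unit_interval_bot: "Rep_unit_interval bot = 0"
  by (simp add: bot_unit_interval_def Abs_unit_interval_inverse)

lemma Rep_unit_interval_top: "Rep_unit_interval top = 1"
  by (simp add: top_unit_interval_def Abs_unit_interval_inverse)

text \<open>The unit \<open>1\<close> is \<^term>\<open>top :: unit_interval\<close>.\<close>

locale left_continuous_tnorm = comm_monoid T "top :: unit_interval"
  for T :: "unit_interval \<Rightarrow> unit_interval \<Rightarrow> unit_interval" +
  assumes Sup_distrib_left: "T (Sup A) b = (SUP a\<in>A. T a b)"
    and Sup_distrib_right: "T b (Sup A) = (SUP a\<in>A. T b a)"
begin

lemma T_mono:
  assumes "a \<le> a'" "b \<le> b'"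
  shows "T a b \<le> T a' b'"
proof -
  have "T a' b' = T (Sup {a, a'}) (Sup {b, b'})"
    using assms by (simp add: sup_absorb2)
  also have "\<dots> = (SUP y\<in>{b, b'}. SUP x\<in>{a, a'}. T x y)"
    by (simp only: Sup_distrib_left Sup_distrib_right)
  finally have "T a' b' = sup (T a b) (sup (T a' b) (sup (T a b') (T a' b')))"
    by (simp add: sup.assoc)
  then show ?thesis by (metis sup_ge1)
qed

end

text \<open>The interval \<open>[0, \<infinity>]\<close> is the type \<^typ>\<open>ennreal\<close>. At \<open>t = 0\<close> the condition below forces
  the value \<open>0\<close>, since the supremum of the empty set is \<open>0\<close>.\<close>

definition left_continuous_distribution :: "(ennreal \<Rightarrow> unit_interval) \<Rightarrow> bool" where
  "left_continuous_distribution g \<longleftrightarrow> (\<forall>t. g t = (SUP s\<in>{s. s < t}. g s))"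

lemma left_continuous_distribution_mono:
  assumes "left_continuous_distribution g" shows "mono g"
proof (rule monoI)
  fix s t :: ennreal assume "s \<le> t"
  have "g t = (SUP s\<in>{s. s < t}. g s)"
    using assms unfolding left_continuous_distribution_def by blast
  then show "g s \<le> g t"
    using \<open>s \<le> t\<close> by (cases "s = t") (auto intro: SUP_upper)
qed

lemma left_continuous_distributionI:
  assumes "mono g" and "\<And>t. g t \<le> (SUP s\<in>{s. s < t}. g s)"
  shows "left_continuous_distribution g"
  unfolding left_continuous_distribution_def
  by (intro allI order.antisym assms(2) SUP_least monoD[OF assms(1)]) simp

lemma left_continuous_distribution_SUP:
  assumes "\<And>g. g \<in> G \<Longrightarrow> left_continuous_distribution g"
  shows "left_continuous_distribution (\<lambda>t. SUP g\<in>G. g t)"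
proof (rule left_continuous_distributionI)
  show "mono (\<lambda>t. SUP g\<in>G. g t)"
    using left_continuous_distribution_mono[OF assms]
    by (auto intro!: monoI SUP_mono dest: monoD)
  fix t
  have "(SUP g\<in>G. g t) = (SUP g\<in>G. SUP s\<in>{s. s < t}. g s)"
    by (rule SUP_cong[OF refl]) (use assms in \<open>auto simp: left_continuous_distribution_def\<close>)
  also have "\<dots> = (SUP s\<in>{s. s < t}. SUP g\<in>G. g s)"
    by (rule SUP_commute)
  finally show "(SUP g\<in>G. g t) \<le> (SUP s\<in>{s. s < t}. SUP g\<in>G. g s)" by simp
qed

typedef ddist = "{g :: ennreal \<Rightarrow> unit_interval. left_continuous_distribution g}"
  morphisms ddist_fun Abs_ddist
  by (rule exI[of _ "\<lambda>_. bot"]) (simp add: left_continuous_distribution_def)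

lemma left_continuous_ddist_fun: "left_continuous_distribution (ddist_fun u)"
  using ddist_fun by auto

text \<open>Suprema are pointwise; an infimum is the supremum of all lower bounds (and is not pointwise
  in general).\<close>

instantiation ddist :: complete_lattice
begin

definition "u \<le> v \<longleftrightarrow> (\<forall>t. ddist_fun u t \<le> ddist_fun v t)"
definition "u < v \<longleftrightarrow> u \<le> v \<and> u \<noteq> (v :: ddist)"
definition "Sup A = Abs_ddist (\<lambda>t. SUP u\<in>A. ddist_fun u t)"
definition "Inf A = Sup {u :: ddist. \<forall>v\<in>A. u \<le> v}"
definition "bot = Abs_ddist (\<lambda>t. bot)"
definition "top = Abs_ddist (\<lambda>t. if t = 0 then bot else top)"
definition "sup u v = Sup {u, v :: ddist}"
definition "inf u v = Inf {u, v :: ddist}"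

lemma ddist_fun_Sup: "ddist_fun (Sup A) t = (SUP u\<in>A. ddist_fun u t)"
proof -
  have "left_continuous_distribution (\<lambda>t. SUP g\<in>ddist_fun ` A. g t)"
    by (rule left_continuous_distribution_SUP) (auto simp: left_continuous_ddist_fun)
  then show ?thesis
    by (simp add: Sup_ddist_def Abs_ddist_inverse image_image)
qed

lemma ddist_fun_bot: "ddist_fun bot t = bot"
  by (simp add: bot_ddist_def Abs_ddist_inverse left_continuous_distribution_def)

lemma ddist_fun_top: "ddist_fun top t = (if t = 0 then bot else top)"
proof -
  have "left_continuous_distribution (\<lambda>t. if t = 0 then bot else top)"
  proof (rule left_continuous_distributionI)
    show "mono (\<lambda>t :: ennreal. if t = 0 then bot else top :: unit_interval)"
      by (auto intro!: monoI)
    fix t :: ennreal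
    show "(if t = 0 then bot else top :: unit_interval) \<le> (SUP s\<in>{s. s < t}. if s = 0 then bot else top)"
    proof (cases "t = 0")
      case False
      then obtain s where "0 < s" "s < t"
        using dense[of 0 t] by (auto simp: zero_less_iff_neq_zero)
      then show ?thesis
        by (intro SUP_upper2[of s]) auto
    qed auto
  qed
  then show ?thesis by (simp add: top_ddist_def Abs_ddist_inverse)
qed

lemma ddist_eqI: "(\<And>t. ddist_fun u t = ddist_fun v t) \<Longrightarrow> u = v"
  using ddist_fun_inject by blast

lemma ddist_fun_0: "ddist_fun u 0 = bot"
proof -
  have "ddist_fun u 0 = (SUP s\<in>{s. s < 0}. ddist_fun u s)"
    using left_continuous_ddist_fun unfolding left_continuous_distribution_def by blast
  then show ?thesis by simp
qed

instance
proof
  fix x y z :: ddist and A :: "ddist set"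
  have up: "x \<le> Sup A" if "x \<in> A" for x and A :: "ddist set"
    using that by (auto simp: less_eq_ddist_def ddist_fun_Sup intro: SUP_upper)
  have least: "Sup A \<le> z" if "\<And>x. x \<in> A \<Longrightarrow> x \<le> z" for z and A :: "ddist set"
    using that by (auto simp: less_eq_ddist_def ddist_fun_Sup intro: SUP_least)
  have low: "Inf A \<le> x" if "x \<in> A" for x and A :: "ddist set"
    using that unfolding Inf_ddist_def by (intro least) auto
  have great: "z \<le> Inf A" if "\<And>x. x \<in> A \<Longrightarrow> z \<le> x" for z and A :: "ddist set"
    using that unfolding Inf_ddist_def by (intro up) auto
  have top: "x \<le> top" for x :: ddist
    by (auto simp: less_eq_ddist_def ddist_fun_top ddist_fun_0)
  have bot: "bot \<le> x" for x :: ddist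
    by (simp add: less_eq_ddist_def ddist_fun_bot)
  show refl: "x \<le> x" and anti: "x \<le> y \<Longrightarrow> y \<le> x \<Longrightarrow> x = y"
    for x y :: ddist by (auto simp: less_eq_ddist_def intro: ddist_eqI antisym)
  show "x \<le> y \<Longrightarrow> y \<le> z \<Longrightarrow> x \<le> z"
    unfolding less_eq_ddist_def by (blast intro: order_trans)
  show "(x < y) = (x \<le> y \<and> \<not> y \<le> x)"
    using anti refl unfolding less_ddist_def by blast
  show "x \<in> A \<Longrightarrow> Inf A \<le> x" "x \<in> A \<Longrightarrow> x \<le> Sup A"
    "(\<And>x. x \<in> A \<Longrightarrow> z \<le> x) \<Longrightarrow> z \<le> Inf A" "(\<And>x. x \<in> A \<Longrightarrow> x \<le> z) \<Longrightarrow> Sup A \<le> z"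
    by (fact low up great least)+
  show "inf x y \<le> x" "inf x y \<le> y" "x \<le> sup x y" "y \<le> sup x y"
    by (auto simp: inf_ddist_def sup_ddist_def intro: low up)
  show "x \<le> y \<Longrightarrow> x \<le> z \<Longrightarrow> x \<le> inf y z" "y \<le> x \<Longrightarrow> z \<le> x \<Longrightarrow> sup y z \<le> x"
    by (auto simp: inf_ddist_def sup_ddist_def intro: great least)
  show "Inf {} = (top :: ddist)" "Sup {} = (bot :: ddist)"
    by (rule anti; (rule top bot great least up)?; simp)+
qed

end

definition ddist_one :: ddist where
  "ddist_one = Abs_ddist (\<lambda>t. if t = 0 then bot else top)"

lemma ddist_one_eq_top: "ddist_one = top"
  by (simp add: ddist_one_def top_ddist_def)

text \<open>The abstraction below is harmless for a left-continuous t-norm: see \<open>ddist_fun_mult\<close>.\<close>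

definition ddist_mult ::
    "(unit_interval \<Rightarrow> unit_interval \<Rightarrow> unit_interval) \<Rightarrow> ddist \<Rightarrow> ddist \<Rightarrow> ddist" where
  "ddist_mult T g h =
     Abs_ddist (\<lambda>t. SUP (r, s)\<in>{(r, s). r + s = t}. T (ddist_fun g r) (ddist_fun h s))"

lemma (in left_continuous_tnorm) ddist_fun_mult:
  "ddist_fun (ddist_mult T g h) t =
     (SUP (r, s)\<in>{(r, s). r + s = t}. T (ddist_fun g r) (ddist_fun h s))"
proof -
  let ?c = "\<lambda>t. SUP (r, s)\<in>{(r, s). r + s = t}. T (ddist_fun g r) (ddist_fun h s)"
  have lc: "ddist_fun u t = (SUP s\<in>{s. s < t}. ddist_fun u s)" for u t
    using left_continuous_ddist_fun unfolding left_continuous_distribution_def by blast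
  have "left_continuous_distribution ?c"
  proof (rule left_continuous_distributionI)
    show "mono ?c"
    proof (rule monoI, rule SUP_least, clarify)
      fix r s t :: ennreal assume "r + s \<le> t"
      then have eq: "(r + (t - (r + s))) + s = t"
        by (metis add.assoc add.commute add_diff_eq_iff_ennreal[symmetric])
      have "T (ddist_fun g r) (ddist_fun h s) \<le> T (ddist_fun g (r + (t - (r + s)))) (ddist_fun h s)"
        by (intro T_mono order_refl monoD[OF left_continuous_distribution_mono]
            left_continuous_ddist_fun) simp
      also have "\<dots> \<le> ?c t"
        using eq by (intro SUP_upper2[of "(r + (t - (r + s)), s)"]) auto
      finally show "T (ddist_fun g r) (ddist_fun h s) \<le> ?c t" .
    qed
    fix t
    show "?c t \<le> (SUP t'\<in>{t'. t' < t}. ?c t')"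
    proof (rule SUP_least, clarify)
      fix r s :: ennreal
      have "T (ddist_fun g r) (ddist_fun h s)
          = (SUP s'\<in>{s'. s' < s}. SUP r'\<in>{r'. r' < r}. T (ddist_fun g r') (ddist_fun h s'))"
        by (subst lc[of g r], subst lc[of h s])
          (simp only: Sup_distrib_left Sup_distrib_right image_image)
      also have "\<dots> \<le> (SUP t'\<in>{t'. t' < r + s}. ?c t')"
      proof (intro SUP_least)
        fix r' s' assume "r' \<in> {r'. r' < r}" "s' \<in> {s'. s' < s}"
        then have "r' + s' < r + s" by (auto intro: add_strict_mono)
        then show "T (ddist_fun g r') (ddist_fun h s') \<le> (SUP t'\<in>{t'. t' < r + s}. ?c t')"
          by (intro SUP_upper2[of "r' + s'"] SUP_upper2[of "(r', s')"]) auto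
      qed
      finally show "T (ddist_fun g r) (ddist_fun h s) \<le> (SUP t'\<in>{t'. t' < r + s}. ?c t')" .
    qed
  qed
  then show ?thesis by (simp add: ddist_mult_def Abs_ddist_inverse)
qed

locale gen_prob_metric_space = left_continuous_tnorm T
  for X :: "'a set"
    and d :: "'a \<Rightarrow> 'a \<Rightarrow> ennreal \<Rightarrow> unit_interval"
    and T :: "unit_interval \<Rightarrow> unit_interval \<Rightarrow> unit_interval" +
  assumes left_continuous:
      "\<lbrakk>x \<in> X; y \<in> X\<rbrakk> \<Longrightarrow> d x y t = (SUP s\<in>{s. s < t}. d x y s)"
    and self: "\<lbrakk>x \<in> X; t > 0\<rbrakk> \<Longrightarrow> d x x t = top"
    and triangle:
      "\<lbrakk>x \<in> X; y \<in> X; z \<in> X\<rbrakk> \<Longrightarrow> T (d x y r) (d y z s) \<le> d x z (r + s)"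

text \<open>This is \<open>d(x, y, -)\<close>; the abstraction is harmless on \<open>X\<close> by \<open>ddist_fun_ddist_of\<close>.\<close>

definition ddist_of :: "('a \<Rightarrow> 'a \<Rightarrow> ennreal \<Rightarrow> unit_interval) \<Rightarrow> 'a \<Rightarrow> 'a \<Rightarrow> ddist" where
  "ddist_of d x y = Abs_ddist (d x y)"

lemma (in gen_prob_metric_space) ddist_fun_ddist_of:
  "\<lbrakk>x \<in> X; y \<in> X\<rbrakk> \<Longrightarrow> ddist_fun (ddist_of d x y) = d x y"
  unfolding ddist_of_def
  by (rule Abs_ddist_inverse) (auto simp: left_continuous_distribution_def intro: left_continuous)

definition left_adjoint_presheaf ::
    "'a set \<Rightarrow> ('a \<Rightarrow> 'a \<Rightarrow> ennreal \<Rightarrow> unit_interval)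
      \<Rightarrow> (unit_interval \<Rightarrow> unit_interval \<Rightarrow> unit_interval)
      \<Rightarrow> ('a \<Rightarrow> ddist) \<Rightarrow> ('a \<Rightarrow> ddist) \<Rightarrow> bool" where
  "left_adjoint_presheaf X d T \<phi> \<psi> \<longleftrightarrow>
     (\<forall>y\<in>X. \<forall>y'\<in>X. ddist_mult T (ddist_of d y' y) (\<phi> y) \<le> \<phi> y') \<and>
     (\<forall>y\<in>X. \<forall>y'\<in>X. ddist_mult T (\<psi> y) (ddist_of d y y') \<le> \<psi> y') \<and>
     ddist_one \<le> (SUP y\<in>X. ddist_mult T (\<psi> y) (\<phi> y)) \<and>
     (\<forall>y\<in>X. \<forall>y'\<in>X. ddist_mult T (\<phi> y) (\<psi> y') \<le> ddist_of d y y')"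

definition cauchy_complete ::
    "'a set \<Rightarrow> ('a \<Rightarrow> 'a \<Rightarrow> ennreal \<Rightarrow> unit_interval)
      \<Rightarrow> (unit_interval \<Rightarrow> unit_interval \<Rightarrow> unit_interval) \<Rightarrow> bool" where
  "cauchy_complete X d T \<longleftrightarrow>
     (\<forall>\<phi> \<psi>. left_adjoint_presheaf X d T \<phi> \<psi> \<longrightarrow> (\<exists>u\<in>X. \<forall>y\<in>X. \<phi> y = ddist_of d y u))"

definition is_fixpoint ::
    "'a set \<Rightarrow> ('a \<Rightarrow> 'a \<Rightarrow> ennreal \<Rightarrow> unit_interval) \<Rightarrow> ('a \<Rightarrow> 'a) \<Rightarrow> 'a \<Rightarrow> bool" where
  "is_fixpoint X d f u \<longleftrightarrow>
     u \<in> X \<and> ddist_of d (f u) u = ddist_one \<and> ddist_of d u (f u) = ddist_one"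

definition directed_poset :: "'i set \<Rightarrow> 'i rel \<Rightarrow> bool" where
  "directed_poset I r \<longleftrightarrow>
     partial_order_on I r \<and> I \<noteq> {} \<and> (\<forall>i\<in>I. \<forall>j\<in>I. \<exists>k\<in>I. (i, k) \<in> r \<and> (j, k) \<in> r)"

definition net_liminf :: "'i set \<Rightarrow> 'i rel \<Rightarrow> ('i \<Rightarrow> 'l::complete_lattice) \<Rightarrow> 'l" where
  "net_liminf I r t = (SUP i\<in>I. INF j\<in>{j\<in>I. (i, j) \<in> r}. t j)"

text \<open>A formula cannot quantify over all index types. The index posets below are carried by subsets
  of one type, chosen large enough that the condition for arbitrary nets follows: this is
  \<open>lower_semicontinuous_net\<close>.\<close>

definition lower_semicontinuous ::
    "('l::complete_lattice \<Rightarrow> 'm::complete_lattice) \<Rightarrow> bool" where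
  "lower_semicontinuous \<phi> \<longleftrightarrow>
     (\<forall>(I :: ('l set \<times> 'l \<times> nat) set) r t. directed_poset I r \<longrightarrow>
        \<phi> (net_liminf I r t) \<le> net_liminf I r (\<lambda>i. \<phi> (t i)))"

text \<open>A net is replaced by one indexed by triples \<open>(S, x, n)\<close> with \<open>S\<close> the set of values of a tail
  and \<open>x \<in> S\<close>; the third component makes the order antisymmetric.\<close>

lemma lower_semicontinuous_net:
  fixes \<phi> :: "'l::complete_lattice \<Rightarrow> 'm::complete_lattice" and I :: "'i set"
  assumes lsc: "lower_semicontinuous \<phi>" and dir: "directed_poset I r"
  shows "\<phi> (net_liminf I r t) \<le> net_liminf I r (\<lambda>i. \<phi> (t i))"
proof -
  define tl where "tl i = t ` {j\<in>I. (i, j) \<in> r}" for i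
  define J :: "('l set \<times> 'l \<times> nat) set"
    where "J = {(S, x, n). S \<in> tl ` I \<and> x \<in> S}"
  define q :: "('l set \<times> 'l \<times> nat) rel"
    where "q = {((S, x, n), (S', x', n')). (S, x, n) \<in> J \<and> (S', x', n') \<in> J \<and>
      ((S, x, n) = (S', x', n') \<or> S' \<subseteq> S \<and> n < n')}"
  have po: "partial_order_on I r" and ne: "I \<noteq> {}"
    and ub: "\<And>i j. \<lbrakk>i \<in> I; j \<in> I\<rbrakk> \<Longrightarrow> \<exists>k\<in>I. (i, k) \<in> r \<and> (j, k) \<in> r"
    using dir unfolding directed_poset_def by auto
  have refl: "(i, i) \<in> r" if "i \<in> I" for i
    using partial_order_onD(1)[OF po] that by (auto dest: refl_onD)
  have self: "t i \<in> tl i" if "i \<in> I" for i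
    using refl that by (auto simp: tl_def)
  have anti: "tl k \<subseteq> tl i" if "(i, k) \<in> r" for i k
    using partial_order_onD(2)[OF po] that unfolding tl_def by (auto dest: transD)
  have q: "directed_poset J q"
    unfolding directed_poset_def partial_order_on_def preorder_on_def
  proof (intro conjI ballI)
    show "q \<subseteq> J \<times> J" by (auto simp: q_def)
    show "refl_on J q" by (auto simp: refl_on_def q_def)
    show "trans q" unfolding trans_def q_def by auto
    show "antisym q" by (auto simp: antisym_def q_def)
    show "J \<noteq> {}" using ne self by (auto simp: J_def)
  next
    fix a b assume "a \<in> J" "b \<in> J"
    then obtain i x n j y m where ab: "a = (tl i, x, n)" "i \<in> I" "b = (tl j, y, m)" "j \<in> I"
      by (auto simp: J_def)
    from ub[OF ab(2,4)] obtain k where k: "k \<in> I" "(i, k) \<in> r" "(j, k) \<in> r" by auto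
    define c where "c = (tl k, t k, Suc (max n m))"
    have "c \<in> J" using k self by (auto simp: c_def J_def)
    moreover have "(a, c) \<in> q" "(b, c) \<in> q"
      using \<open>a \<in> J\<close> \<open>b \<in> J\<close> \<open>c \<in> J\<close> anti[OF k(2)] anti[OF k(3)]
      by (auto simp: ab c_def q_def)
    ultimately show "\<exists>c\<in>J. (a, c) \<in> q \<and> (b, c) \<in> q" by blast
  qed
  have tail: "(\<lambda>a. fst (snd a)) ` {b\<in>J. (a, b) \<in> q} = S"
    if "a = (S, x, n)" "a \<in> J" for a S x n
  proof (intro equalityI subsetI)
    fix z assume "z \<in> S"
    then have "(S, z, Suc n) \<in> {b\<in>J. (a, b) \<in> q}"
      using that by (auto simp: J_def q_def)
    then show "z \<in> (\<lambda>a. fst (snd a)) ` {b\<in>J. (a, b) \<in> q}"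
      by (rule rev_image_eqI) simp
  next
    fix z assume "z \<in> (\<lambda>a. fst (snd a)) ` {b\<in>J. (a, b) \<in> q}"
    then show "z \<in> S" using that by (auto simp: J_def q_def)
  qed
  have eq: "net_liminf J q (\<lambda>a. h (fst (snd a))) = net_liminf I r (\<lambda>i. h (t i))"
    for h :: "'l \<Rightarrow> 'z::complete_lattice"
  proof -
    have inner: "(INF b\<in>{b\<in>J. (a, b) \<in> q}. h (fst (snd b))) = Inf (h ` fst a)" if "a \<in> J" for a
    proof -
      have "(INF b\<in>{b\<in>J. (a, b) \<in> q}. h (fst (snd b)))
          = Inf (h ` ((\<lambda>a. fst (snd a)) ` {b\<in>J. (a, b) \<in> q}))"
        by (simp only: image_image)
      also have "\<dots> = Inf (h ` fst a)"
        using tail[of a "fst a" "fst (snd a)" "snd (snd a)"] that by simp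
      finally show ?thesis .
    qed
    have "net_liminf J q (\<lambda>a. h (fst (snd a))) = (SUP a\<in>J. Inf (h ` fst a))"
      unfolding net_liminf_def by (rule SUP_cong) (simp_all add: inner)
    also have "\<dots> = (SUP S\<in>fst ` J. Inf (h ` S))" by (simp only: image_image)
    also have "fst ` J = tl ` I"
    proof (intro equalityI subsetI)
      fix S assume "S \<in> tl ` I"
      then obtain i where "i \<in> I" "S = tl i" by auto
      then have "(S, t i, 0) \<in> J" using self by (auto simp: J_def)
      then show "S \<in> fst ` J" by (rule rev_image_eqI) simp
    qed (auto simp: J_def)
    also have "(SUP S\<in>tl ` I. Inf (h ` S)) = net_liminf I r (\<lambda>i. h (t i))"
      by (simp only: net_liminf_def tl_def image_image)
    finally show ?thesis .
  qed
  have "\<phi> (net_liminf J q (\<lambda>a. fst (snd a))) \<le> net_liminf J q (\<lambda>a. \<phi> (fst (snd a)))"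
    using lsc q unfolding lower_semicontinuous_def by blast
  then show ?thesis
    using eq[of "\<lambda>x. x"] eq[of \<phi>] by simp
qed

end

theory Submission
  imports Defs
begin

text \<open>
  The theorem is the Boyd--Wong fixpoint argument carried out in the quantale \<open>\<Delta>\<close> of distance
  distributions. Follow the orbit \<open>x\<^sub>n = f\<^sup>n x\<close> of a point \<open>x\<close> as in the last hypothesis, and write
  \<open>D n m\<close> for the distribution \<open>d(x\<^sub>n, x\<^sub>m, -)\<close>. Large values in \<open>\<Delta>\<close> mean small distances, and
  convergence is expressed by a lower limit being the top element \<open>e\<close>.

  Everything rests on one observation: if a value \<open>L\<close> is not \<open>0\<close> and \<open>\<phi> L \<le> L\<close>, then \<open>L = e\<close>.
  Lower-semicontinuity produces such values, because \<open>\<phi> (liminf t) \<le> liminf (\<phi> \<circ> t)\<close>, and for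
  distances \<open>t\<close> along the orbit the right-hand side is bounded by a lower limit of the distances
  one step later on the orbit.

  First, with \<open>t n = D n (n + 1)\<close> the later distances have the same lower limit as the original
  ones, so consecutive orbit points become arbitrarily close, in both directions. Second, the orbit
  is a Cauchy sequence. If it were not, there would be an \<open>\<epsilon>\<close> totally below \<open>e\<close> and, arbitrarily far
  out, pairs \<open>n < m\<close> for which \<open>\<epsilon> \<le> D n m\<close> fails for the first time. Since \<open>\<epsilon> \<le> D n (m - 1)\<close>
  and consecutive points become close, the lower limit \<open>L\<close> of these distances is still at least
  \<open>\<epsilon>\<close>, hence not \<open>0\<close>; and since moving both points one step on does not raise the lower limit,
  again because consecutive points become close, \<open>\<phi> L \<le> L\<close>. Hence \<open>L = e\<close>, and \<open>\<epsilon>\<close>, being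
  totally below \<open>e\<close>, lies below one of these distances after all. The step functions supply enough
  elements totally below \<open>e\<close>. Distances \<open>D m n\<close> in the other direction are covered by the same
  argument, since \<open>*\<close> is commutative and the transposed \<open>D\<close> has all the properties used.

  Third, the Cauchy orbit defines a left adjoint presheaf \<open>y \<mapsto> liminf d(y, x\<^sub>n, -)\<close>, with right
  adjoint \<open>y \<mapsto> liminf d(x\<^sub>n, y, -)\<close>, and a point \<open>u\<close> representing it is a limit of the orbit. One
  more use of lower-semicontinuity, together with \<open>\<phi> e = e\<close>, shows that \<open>f u\<close> is a limit too, and
  so \<open>u\<close> and \<open>f u\<close> are at distance \<open>e\<close> in both directions.
\<close>

section \<open>Lower limits of sequences in a complete lattice\<close>

lemma lower_semicontinuous_liminf:
  assumes "lower_semicontinuous \<phi>"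
  shows "\<phi> (liminf t) \<le> liminf (\<lambda>n. \<phi> (t n))"
proof -
  have "directed_poset UNIV {(i::nat, j). i \<le> j}"
    unfolding directed_poset_def partial_order_on_def preorder_on_def
    by (auto simp: refl_on_def trans_def antisym_def intro: max.cobounded1 max.cobounded2)
  then have "\<phi> (net_liminf UNIV {(i::nat, j). i \<le> j} t)
      \<le> net_liminf UNIV {(i::nat, j). i \<le> j} (\<lambda>n. \<phi> (t n))"
    by (rule lower_semicontinuous_net[OF assms])
  then show ?thesis
    by (simp add: net_liminf_def liminf_SUP_INF atLeast_def)
qed

lemma liminf_le_along:
  fixes a :: "nat \<Rightarrow> 'q::complete_lattice"
  assumes "\<And>k. k \<le> m k"
  shows "liminf a \<le> liminf (\<lambda>k. a (m k))"
  unfolding liminf_SUP_INF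
  by (intro SUP_mono' INF_greatest INF_lower) (use assms order_trans in auto)

lemma liminf_Suc_le:
  fixes a :: "nat \<Rightarrow> 'q::complete_lattice"
  shows "liminf (\<lambda>n. a (Suc n)) \<le> liminf a"
  unfolding liminf_SUP_INF
proof (rule SUP_least)
  fix N
  have "(INF n\<in>{N..}. a (Suc n)) \<le> (INF n\<in>{Suc N..}. a n)"
    by (rule INF_mono) (metis Suc_le_D Suc_le_mono atLeast_iff order_refl)
  also have "\<dots> \<le> (SUP N. INF n\<in>{N..}. a n)"
    by (rule SUP_upper) simp
  finally show "(INF n\<in>{N..}. a (Suc n)) \<le> (SUP N. INF n\<in>{N..}. a n)" .
qed

lemma liminf_pointwise_mono:
  fixes a b :: "nat \<Rightarrow> 'q::complete_lattice"
  assumes "\<And>n. a n \<le> b n"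
  shows "liminf a \<le> liminf b"
  using assms by (intro Liminf_mono) simp

section \<open>Contractive kernels with values in an integral quantale\<close>

text \<open>The arguments about the orbit use the values in \<open>\<Delta>\<close> only through the lattice order and a
  commutative multiplication that has the top element as unit and preserves suprema.\<close>

locale integral_multiplication =
  fixes mult :: "'q::complete_lattice \<Rightarrow> 'q \<Rightarrow> 'q"  (infixl "\<odot>" 70)
  assumes mult_commute: "a \<odot> b = b \<odot> a"
    and top_mult: "top \<odot> a = a"
    and Sup_mult: "Sup A \<odot> b = (SUP a\<in>A. a \<odot> b)"
begin

lemma mult_top: "a \<odot> top = a"
  using mult_commute[of a top] top_mult[of a] by simp

lemma mult_Sup: "b \<odot> Sup A = (SUP a\<in>A. b \<odot> a)"
  using Sup_mult[of A b] by (simp add: mult_commute)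

lemma mult_mono_left:
  assumes "a \<le> a'"
  shows "a \<odot> b \<le> a' \<odot> b"
proof -
  have "a' \<odot> b = Sup {a, a'} \<odot> b"
    using assms by (simp add: sup_absorb2)
  also have "\<dots> = sup (a \<odot> b) (a' \<odot> b)"
    by (simp only: Sup_mult) simp
  finally show ?thesis by (metis sup_ge1)
qed

lemma mult_mono:
  assumes "a \<le> a'" "b \<le> b'"
  shows "a \<odot> b \<le> a' \<odot> b'"
  using mult_mono_left[OF assms(1), of b] mult_mono_left[OF assms(2), of a']
  by (simp add: mult_commute[of a'])

text \<open>This is where preservation of suprema enters: it reduces the claim to the tails of the two
  sequences, and two tails have a common later one.\<close>

lemma liminf_mult_le: "liminf a \<odot> liminf b \<le> liminf (\<lambda>n. a n \<odot> b n)"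
proof -
  have "liminf a \<odot> liminf b
      = (SUP M. SUP N. (INF n\<in>{N..}. a n) \<odot> (INF m\<in>{M..}. b m))"
    by (simp only: liminf_SUP_INF Sup_mult mult_Sup image_image)
  also have "\<dots> \<le> liminf (\<lambda>n. a n \<odot> b n)"
  proof (intro SUP_least)
    fix N M :: nat
    have "(INF n\<in>{N..}. a n) \<odot> (INF m\<in>{M..}. b m) \<le> (INF n\<in>{max N M..}. a n \<odot> b n)"
      by (intro INF_greatest mult_mono INF_lower) auto
    also have "\<dots> \<le> liminf (\<lambda>n. a n \<odot> b n)"
      unfolding liminf_SUP_INF by (rule SUP_upper) simp
    finally show "(INF n\<in>{N..}. a n) \<odot> (INF m\<in>{M..}. b m) \<le> liminf (\<lambda>n. a n \<odot> b n)" .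
  qed
  finally show ?thesis .
qed

end

text \<open>The kernel \<open>D\<close> stands for the distances between the points of an orbit; contractivity of the
  map then says that shifting both indices raises \<open>D\<close> at least to its image under \<open>\<phi>\<close>.\<close>

locale contractive_kernel = integral_multiplication mult
  for mult :: "'q::complete_lattice \<Rightarrow> 'q \<Rightarrow> 'q"  (infixl "\<odot>" 70) +
  fixes \<phi> :: "'q \<Rightarrow> 'q"
    and D :: "nat \<Rightarrow> nat \<Rightarrow> 'q"
  assumes lsc: "lower_semicontinuous \<phi>"
    and expanding: "bot < u \<Longrightarrow> u < top \<Longrightarrow> u < \<phi> u"
    and phi_top: "\<phi> top = top"
    and kernel_refl: "D n n = top"
    and kernel_trans: "D i j \<odot> D j k \<le> D i k"
    and contractive: "\<phi> (D n m) \<le> D (Suc n) (Suc m)"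
    and forward_nonbot: "D 0 1 \<noteq> bot"
    and backward_nonbot: "D 1 0 \<noteq> bot"
begin

lemma transpose: "contractive_kernel (\<odot>) \<phi> (\<lambda>n m. D m n)"
proof unfold_locales
  show "D j i \<odot> D k j \<le> D k i" for i j k
    using kernel_trans[of k j i] by (simp add: mult_commute)
qed (use lsc expanding phi_top kernel_refl contractive forward_nonbot backward_nonbot in auto)

lemma top_of_phi_le:
  assumes "L \<noteq> bot" "\<phi> L \<le> L"
  shows "L = top"
  using expanding[of L] assms by (metis bot.not_eq_extremum leD top.not_eq_extremum)

lemma le_phi:
  assumes "u \<noteq> bot"
  shows "u \<le> \<phi> u"
  using assms expanding[of u] phi_top
  by (metis bot.not_eq_extremum less_imp_le order_refl top.not_eq_extremum)

lemma kernel_step_ge: "D 0 1 \<le> D n (Suc n)"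
proof (induction n)
  case (Suc n)
  have "D n (Suc n) \<noteq> bot"
    using Suc forward_nonbot by (metis bot.extremum_uniqueI)
  then have "D n (Suc n) \<le> D (Suc n) (Suc (Suc n))"
    using le_phi contractive order_trans by blast
  with Suc show ?case by (rule order_trans)
qed simp

text \<open>The lower limit is not \<open>0\<close> because the steps never drop below the first one.\<close>

lemma liminf_steps_top: "liminf (\<lambda>n. D n (Suc n)) = top"
proof (rule top_of_phi_le)
  have "D 0 1 \<le> liminf (\<lambda>n. D n (Suc n))"
    by (rule Liminf_bounded) (use kernel_step_ge in auto)
  then show "liminf (\<lambda>n. D n (Suc n)) \<noteq> bot"
    using forward_nonbot by (metis bot.extremum_uniqueI)
  have "\<phi> (liminf (\<lambda>n. D n (Suc n))) \<le> liminf (\<lambda>n. \<phi> (D n (Suc n)))"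
    by (rule lower_semicontinuous_liminf[OF lsc])
  also have "\<dots> \<le> liminf (\<lambda>n. D (Suc n) (Suc (Suc n)))"
    by (rule liminf_pointwise_mono) (rule contractive)
  also have "\<dots> \<le> liminf (\<lambda>n. D n (Suc n))"
    by (rule liminf_Suc_le)
  finally show "\<phi> (liminf (\<lambda>n. D n (Suc n))) \<le> liminf (\<lambda>n. D n (Suc n))" .
qed

lemma liminf_steps_along:
  assumes "\<And>k. k \<le> m k"
  shows "liminf (\<lambda>k. D (m k) (Suc (m k))) = top"
  using liminf_le_along[of m "\<lambda>n. D n (Suc n)", OF assms] liminf_steps_top
  by (simp add: top.extremum_unique)

text \<open>Going from \<open>n k\<close> one step forward, then across, then one step back costs nothing in the
  limit, since all steps tend to the top element.\<close>

lemma liminf_shift_le: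
  assumes n: "\<And>k. k \<le> n k" and m: "\<And>k. k \<le> m k"
  shows "liminf (\<lambda>k. D (Suc (n k)) (Suc (m k))) \<le> liminf (\<lambda>k. D (n k) (m k))"
proof -
  interpret op: contractive_kernel "(\<odot>)" \<phi> "\<lambda>n m. D m n"
    by (rule transpose)
  let ?L = "liminf (\<lambda>k. D (Suc (n k)) (Suc (m k)))"
  have "?L = liminf (\<lambda>k. D (n k) (Suc (n k))) \<odot> ?L \<odot> liminf (\<lambda>k. D (Suc (m k)) (m k))"
    by (simp add: liminf_steps_along[OF n] op.liminf_steps_along[OF m] top_mult mult_top)
  also have "\<dots> \<le> liminf (\<lambda>k. D (n k) (Suc (n k)) \<odot> D (Suc (n k)) (Suc (m k)))
      \<odot> liminf (\<lambda>k. D (Suc (m k)) (m k))"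
    by (intro mult_mono liminf_mult_le order_refl)
  also have "\<dots> \<le> liminf (\<lambda>k. D (n k) (Suc (m k))) \<odot> liminf (\<lambda>k. D (Suc (m k)) (m k))"
    by (intro mult_mono liminf_pointwise_mono kernel_trans order_refl)
  also have "\<dots> \<le> liminf (\<lambda>k. D (n k) (Suc (m k)) \<odot> D (Suc (m k)) (m k))"
    by (rule liminf_mult_le)
  also have "\<dots> \<le> liminf (\<lambda>k. D (n k) (m k))"
    by (intro liminf_pointwise_mono kernel_trans)
  finally show ?thesis .
qed

text \<open>If \<open>\<epsilon>\<close> failed infinitely often, the pairs at which it fails for the first time would have
  lower limit top, by the argument for consecutive points; but an element totally below top
  cannot stay outside all members of a sequence with that lower limit.\<close>

lemma totally_below_le_liminf:
  assumes totally_below: "\<And>A. Sup A = top \<Longrightarrow> \<exists>a\<in>A. \<epsilon> \<le> a"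
  shows "\<epsilon> \<le> liminf (\<lambda>n. liminf (D n))"
proof (rule ccontr)
  assume not_le: "\<not> \<epsilon> \<le> liminf (\<lambda>n. liminf (D n))"
  have "\<exists>n m. k \<le> n \<and> n \<le> m \<and> \<epsilon> \<le> D n m \<and> \<not> \<epsilon> \<le> D n (Suc m)" for k
  proof -
    have "\<exists>n\<ge>k. \<not> \<epsilon> \<le> liminf (D n)"
    proof (rule ccontr)
      assume "\<not> ?thesis"
      then have "\<epsilon> \<le> liminf (\<lambda>n. liminf (D n))"
        by - (rule Liminf_bounded, rule eventually_sequentiallyI[of k], simp)
      then show False using not_le by simp
    qed
    then obtain n where n: "k \<le> n" "\<not> \<epsilon> \<le> liminf (D n)"
      by auto
    have "\<exists>m\<ge>n. \<not> \<epsilon> \<le> D n m"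
    proof (rule ccontr)
      assume "\<not> ?thesis"
      then have "\<epsilon> \<le> liminf (D n)"
        by (intro Liminf_bounded eventually_sequentiallyI[of n]) auto
      then show False using n by simp
    qed
    \<comment> \<open>Since \<open>D n n = top\<close>, there is a first index after \<open>n\<close> at which \<open>\<epsilon>\<close> fails.\<close>
    then obtain i where "\<not> \<epsilon> \<le> D n (n + i)"
      by (metis le_iff_add)
    moreover have "\<epsilon> \<le> D n (n + 0)"
      by (simp add: kernel_refl)
    ultimately obtain j where "\<epsilon> \<le> D n (n + j)" "\<not> \<epsilon> \<le> D n (n + Suc j)"
      using dec_induct[of 0 i "\<lambda>j. \<epsilon> \<le> D n (n + j)"] by blast
    with n show ?thesis
      by (metis add_Suc_right le_add1)
  qed
  then obtain n m where nm: "\<And>k. k \<le> n k" "\<And>k. n k \<le> m k"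
    and before: "\<And>k. \<epsilon> \<le> D (n k) (m k)" and fails: "\<And>k. \<not> \<epsilon> \<le> D (n k) (Suc (m k))"
    by metis
  have m: "k \<le> m k" for k
    using nm order_trans by blast
  define L where "L = liminf (\<lambda>k. D (n k) (Suc (m k)))"
  have "\<epsilon> = liminf (\<lambda>k::nat. \<epsilon>) \<odot> liminf (\<lambda>k. D (m k) (Suc (m k)))"
    by (simp add: liminf_steps_along[OF m] Liminf_const mult_top)
  also have "\<dots> \<le> liminf (\<lambda>k. D (n k) (m k)) \<odot> liminf (\<lambda>k. D (m k) (Suc (m k)))"
    by (intro mult_mono liminf_pointwise_mono before order_refl)
  also have "\<dots> \<le> liminf (\<lambda>k. D (n k) (m k) \<odot> D (m k) (Suc (m k)))"
    by (rule liminf_mult_le)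
  also have "\<dots> \<le> L"
    unfolding L_def by (intro liminf_pointwise_mono kernel_trans)
  finally have "\<epsilon> \<le> L" .
  moreover have "\<epsilon> \<noteq> bot"
    using fails by auto
  ultimately have "L \<noteq> bot"
    by (metis bot.extremum_uniqueI)
  moreover have "\<phi> L \<le> L"
  proof -
    have "\<phi> L \<le> liminf (\<lambda>k. \<phi> (D (n k) (Suc (m k))))"
      unfolding L_def by (rule lower_semicontinuous_liminf[OF lsc])
    also have "\<dots> \<le> liminf (\<lambda>k. D (Suc (n k)) (Suc (Suc (m k))))"
      by (intro liminf_pointwise_mono contractive)
    also have "\<dots> \<le> L"
      unfolding L_def by (intro liminf_shift_le nm(1) le_SucI m)
    finally show ?thesis .
  qed
  ultimately have "L = top"
    by (rule top_of_phi_le)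
  then have "(SUP N. INF k\<in>{N..}. D (n k) (Suc (m k))) = top"
    by (simp add: L_def liminf_SUP_INF)
  then obtain N where "\<epsilon> \<le> (INF k\<in>{N..}. D (n k) (Suc (m k)))"
    using totally_below by blast
  also have "\<dots> \<le> D (n N) (Suc (m N))"
    by (rule INF_lower) simp
  finally show False
    using fails by blast
qed

end

section \<open>The quantale of distance distributions\<close>

context left_continuous_tnorm
begin

lemma ddist_mult_commute: "ddist_mult T g h = ddist_mult T h g"
proof (rule ddist_eqI)
  fix t :: ennreal
  have le: "ddist_fun (ddist_mult T g h) t \<le> ddist_fun (ddist_mult T h g) t" for g h
    unfolding ddist_fun_mult
  proof (rule SUP_least, clarify)
    fix r s :: ennreal
    have "T (ddist_fun g r) (ddist_fun h s) = T (ddist_fun h s) (ddist_fun g r)"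
      by (rule commute)
    also have "\<dots> \<le> (SUP (r', s')\<in>{(r', s'). r' + s' = r + s}. T (ddist_fun h r') (ddist_fun g s'))"
      by (rule SUP_upper2[of "(s, r)"]) (auto simp: add.commute)
    finally show "T (ddist_fun g r) (ddist_fun h s)
      \<le> (SUP (r', s')\<in>{(r', s'). r' + s' = r + s}. T (ddist_fun h r') (ddist_fun g s'))" .
  qed
  show "ddist_fun (ddist_mult T g h) t = ddist_fun (ddist_mult T h g) t"
    by (intro order.antisym le)
qed

text \<open>Left-continuity of \<open>h\<close> is essential for the lower bound: the top element vanishes at \<open>0\<close>, so
  the product at \<open>t\<close> sees \<open>h\<close> only at arguments below \<open>t\<close>.\<close>

lemma ddist_top_mult: "ddist_mult T top h = h"
proof (rule ddist_eqI)
  fix t :: ennreal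
  show "ddist_fun (ddist_mult T top h) t = ddist_fun h t"
  proof (rule order.antisym)
    show "ddist_fun (ddist_mult T top h) t \<le> ddist_fun h t"
      unfolding ddist_fun_mult
    proof (rule SUP_least, clarify)
      fix r s :: ennreal
      have "T (ddist_fun top r) (ddist_fun h s) \<le> T top (ddist_fun h s)"
        by (intro T_mono) auto
      also have "\<dots> = ddist_fun h s"
        by (simp add: left_neutral)
      also have "\<dots> \<le> ddist_fun h (r + s)"
        by (rule monoD[OF left_continuous_distribution_mono[OF left_continuous_ddist_fun]]) simp
      finally show "T (ddist_fun top r) (ddist_fun h s) \<le> ddist_fun h (r + s)" .
    qed
    have "ddist_fun h t = (SUP s\<in>{s. s < t}. ddist_fun h s)"
      using left_continuous_ddist_fun unfolding left_continuous_distribution_def by blast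
    also have "\<dots> \<le> ddist_fun (ddist_mult T top h) t"
    proof (rule SUP_least, clarify)
      fix s assume "s < t"
      then have gap: "t - s \<noteq> 0" and sum: "(t - s) + s = t"
        by (auto simp: diff_eq_0_iff_ennreal diff_add_cancel_ennreal)
      have "ddist_fun h s = T (ddist_fun top (t - s)) (ddist_fun h s)"
        using gap by (simp add: ddist_fun_top left_neutral)
      also have "\<dots> \<le> ddist_fun (ddist_mult T top h) t"
        unfolding ddist_fun_mult using sum by (intro SUP_upper2[of "(t - s, s)"]) auto
      finally show "ddist_fun h s \<le> ddist_fun (ddist_mult T top h) t" .
    qed
    finally show "ddist_fun h t \<le> ddist_fun (ddist_mult T top h) t" .
  qed
qed

lemma ddist_Sup_mult: "ddist_mult T (Sup A) h = (SUP g\<in>A. ddist_mult T g h)"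
proof (rule ddist_eqI)
  fix t :: ennreal
  let ?R = "{(r, s). r + s = t}"
  have "ddist_fun (ddist_mult T (Sup A) h) t
      = (SUP (r, s)\<in>?R. SUP g\<in>A. T (ddist_fun g r) (ddist_fun h s))"
    by (simp only: ddist_fun_mult ddist_fun_Sup Sup_distrib_left image_image)
  also have "\<dots> = (SUP g\<in>A. SUP (r, s)\<in>?R. T (ddist_fun g r) (ddist_fun h s))"
    unfolding case_prod_beta by (rule SUP_commute)
  also have "\<dots> = ddist_fun (SUP g\<in>A. ddist_mult T g h) t"
    by (simp only: ddist_fun_mult ddist_fun_Sup image_image)
  finally show "ddist_fun (ddist_mult T (Sup A) h) t = ddist_fun (SUP g\<in>A. ddist_mult T g h) t" .
qed

sublocale ddist: integral_multiplication "ddist_mult T"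
  by unfold_locales (fact ddist_mult_commute ddist_top_mult ddist_Sup_mult)+

end

lemma unit_interval_dense_below_top:
  fixes a :: unit_interval
  assumes "a < top"
  obtains p where "a < p" "p < top"
proof -
  let ?r = "(Rep_unit_interval a + 1) / 2"
  have "Rep_unit_interval a < 1"
    using assms by (simp add: less_unit_interval_def Rep_unit_interval_top)
  moreover have "Rep_unit_interval (Abs_unit_interval ?r) = ?r"
    using Rep_unit_interval_bounds[of a] by (intro Abs_unit_interval_inverse) auto
  ultimately show thesis
    by (intro that[of "Abs_unit_interval ?r"])
      (simp_all add: less_unit_interval_def Rep_unit_interval_top)
qed

text \<open>Step functions with a jump at \<open>c > 0\<close> to a height \<open>p\<close> below \<open>1\<close> are totally below the top
  element: a supremum equal to the top element has value \<open>1\<close> at \<open>c\<close>, so one of its members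
  exceeds \<open>p\<close> there. Letting \<open>c\<close> tend to \<open>0\<close> and \<open>p\<close> to \<open>1\<close> exhausts the top element.
  Hence top is the supremum of the elements totally below it.\<close>

lemma ddist_eq_topI:
  assumes above: "\<And>\<epsilon>. (\<And>A. Sup A = top \<Longrightarrow> \<exists>a\<in>A. \<epsilon> \<le> a) \<Longrightarrow> \<epsilon> \<le> u"
  shows "u = (top :: ddist)"
proof (rule ccontr)
  assume "u \<noteq> top"
  then obtain t where t: "ddist_fun u t \<noteq> ddist_fun top t"
    using ddist_eqI by blast
  then have "t \<noteq> 0"
    by (metis ddist_fun_0)
  then have "ddist_fun u t < top"
    using t by (simp add: ddist_fun_top top.not_eq_extremum)
  then obtain p where p: "ddist_fun u t < p" "p < top"
    by (rule unit_interval_dense_below_top)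
  obtain c where c: "0 < c" "c < t"
    using \<open>t \<noteq> 0\<close> dense[of 0 t] by (auto simp: zero_less_iff_neq_zero)
  let ?step = "\<lambda>t. if c < t then p else bot"
  have "left_continuous_distribution ?step"
  proof (rule left_continuous_distributionI)
    show "mono ?step"
      by (auto intro!: monoI)
    fix s
    show "?step s \<le> (SUP r\<in>{r. r < s}. ?step r)"
    proof (cases "c < s")
      case True
      then obtain r where "c < r" "r < s"
        using dense by blast
      then show ?thesis
        by (intro SUP_upper2[of r]) auto
    qed simp
  qed
  then have step: "ddist_fun (Abs_ddist ?step) = ?step"
    by (simp add: Abs_ddist_inverse)
  have "Abs_ddist ?step \<le> u"
  proof (rule above)
    fix A :: "ddist set" assume "Sup A = top"
    then have "(SUP a\<in>A. ddist_fun a c) = top"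
      using c ddist_fun_Sup[of A c] ddist_fun_top[of c] by (metis less_irrefl)
    then obtain a where a: "a \<in> A" "p < ddist_fun a c"
      using p by (metis less_SUP_iff)
    have "p \<le> ddist_fun a s" if "c < s" for s
      using a that monoD[OF left_continuous_distribution_mono[OF left_continuous_ddist_fun], of c s a]
      by (auto intro: order_trans less_imp_le)
    then have "Abs_ddist ?step \<le> a"
      by (auto simp: less_eq_ddist_def step)
    then show "\<exists>a\<in>A. Abs_ddist ?step \<le> a"
      using a by blast
  qed
  then have "p \<le> ddist_fun u t"
    using c by (auto simp: less_eq_ddist_def step dest: spec[of _ t])
  then show False
    using p by simp
qed

section \<open>Limits of Cauchy sequences in a Cauchy-complete space\<close>

context gen_prob_metric_space
begin

lemma ddist_of_self:
  assumes "x \<in> X"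
  shows "ddist_of d x x = top"
proof (rule ddist_eqI)
  fix t
  show "ddist_fun (ddist_of d x x) t = ddist_fun top t"
  proof (cases "t = 0")
    case False
    then show ?thesis
      using assms self[of x t] by (simp add: ddist_fun_ddist_of ddist_fun_top zero_less_iff_neq_zero)
  qed (simp add: ddist_fun_0)
qed

lemma ddist_of_triangle:
  assumes "x \<in> X" "y \<in> X" "z \<in> X"
  shows "ddist_mult T (ddist_of d x y) (ddist_of d y z) \<le> ddist_of d x z"
  using assms
  by (auto simp: less_eq_ddist_def ddist_fun_mult ddist_fun_ddist_of intro!: SUP_least triangle)

lemma liminf_triangle:
  assumes "\<And>n. x n \<in> X" "y \<in> X" "z \<in> X"
  shows "ddist_mult T (liminf (\<lambda>n. ddist_of d y (x n))) (liminf (\<lambda>n. ddist_of d (x n) z))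
    \<le> ddist_of d y z"
proof -
  have "ddist_mult T (liminf (\<lambda>n. ddist_of d y (x n))) (liminf (\<lambda>n. ddist_of d (x n) z))
      \<le> liminf (\<lambda>n. ddist_mult T (ddist_of d y (x n)) (ddist_of d (x n) z))"
    by (rule ddist.liminf_mult_le)
  also have "\<dots> \<le> liminf (\<lambda>n::nat. ddist_of d y z)"
    using assms by (intro liminf_pointwise_mono ddist_of_triangle)
  finally show ?thesis
    by (simp add: Liminf_const)
qed

text \<open>The two lower limits below are adjoint: \<open>\<phi> y * \<psi> y' \<le> d(y, y', -)\<close> is the triangle
  inequality through the sequence, and the covering condition holds already on the members of the
  sequence, by the Cauchy property.\<close>

lemma cauchy_sequence_left_adjoint:
  assumes x: "\<And>n. x n \<in> X"
    and fwd: "liminf (\<lambda>n. liminf (\<lambda>m. ddist_of d (x n) (x m))) = top"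
    and bwd: "liminf (\<lambda>n. liminf (\<lambda>m. ddist_of d (x m) (x n))) = top"
  shows "left_adjoint_presheaf X d T
    (\<lambda>y. liminf (\<lambda>n. ddist_of d y (x n))) (\<lambda>y. liminf (\<lambda>n. ddist_of d (x n) y))"
    (is "left_adjoint_presheaf X d T ?\<phi> ?\<psi>")
  unfolding left_adjoint_presheaf_def
proof (intro conjI ballI)
  fix y y' assume y: "y \<in> X" "y' \<in> X"
  have const: "liminf (\<lambda>n::nat. c) = c" for c :: ddist
    by (simp add: Liminf_const)
  have "ddist_mult T (ddist_of d y' y) (?\<phi> y)
      \<le> liminf (\<lambda>n. ddist_mult T (ddist_of d y' y) (ddist_of d y (x n)))"
    using ddist.liminf_mult_le[of "\<lambda>n. ddist_of d y' y"] by (simp add: const)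
  also have "\<dots> \<le> ?\<phi> y'"
    using x y by (intro liminf_pointwise_mono ddist_of_triangle)
  finally show "ddist_mult T (ddist_of d y' y) (?\<phi> y) \<le> ?\<phi> y'" .
  have "ddist_mult T (?\<psi> y) (ddist_of d y y')
      \<le> liminf (\<lambda>n. ddist_mult T (ddist_of d (x n) y) (ddist_of d y y'))"
    using ddist.liminf_mult_le[of _ "\<lambda>n. ddist_of d y y'"] by (simp add: const)
  also have "\<dots> \<le> ?\<psi> y'"
    using x y by (intro liminf_pointwise_mono ddist_of_triangle)
  finally show "ddist_mult T (?\<psi> y) (ddist_of d y y') \<le> ?\<psi> y'" .
  show "ddist_mult T (?\<phi> y) (?\<psi> y') \<le> ddist_of d y y'"
    using x y by (rule liminf_triangle)
next
  have "ddist_one = ddist_mult T (liminf (\<lambda>n. ?\<psi> (x n))) (liminf (\<lambda>n. ?\<phi> (x n)))"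
    by (simp add: fwd bwd ddist.mult_top ddist_one_eq_top)
  also have "\<dots> \<le> liminf (\<lambda>n. ddist_mult T (?\<psi> (x n)) (?\<phi> (x n)))"
    by (rule ddist.liminf_mult_le)
  also have "\<dots> \<le> liminf (\<lambda>n::nat. SUP y\<in>X. ddist_mult T (?\<psi> y) (?\<phi> y))"
    using x by (intro liminf_pointwise_mono SUP_upper)
  also have "\<dots> = (SUP y\<in>X. ddist_mult T (?\<psi> y) (?\<phi> y))"
    by (simp add: Liminf_const)
  finally show "ddist_one \<le> (SUP y\<in>X. ddist_mult T (?\<psi> y) (?\<phi> y))" .
qed

text \<open>The representing point \<open>u\<close> satisfies \<open>\<phi> u = d(u, u, -)\<close>, which is top. For the other direction,
  representability turns the covering condition into \<open>e \<le> \<Squnion>\<^sub>y \<psi> y * d(y, u, -)\<close>, and the action of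
  the space on \<open>\<psi>\<close> bounds the right-hand side by \<open>\<psi> u\<close>.\<close>

lemma cauchy_sequence_limit:
  assumes complete: "cauchy_complete X d T"
    and x: "\<And>n. x n \<in> X"
    and fwd: "liminf (\<lambda>n. liminf (\<lambda>m. ddist_of d (x n) (x m))) = top"
    and bwd: "liminf (\<lambda>n. liminf (\<lambda>m. ddist_of d (x m) (x n))) = top"
  obtains u where "u \<in> X"
    "liminf (\<lambda>n. ddist_of d u (x n)) = top" "liminf (\<lambda>n. ddist_of d (x n) u) = top"
proof -
  let ?\<phi> = "\<lambda>y. liminf (\<lambda>n. ddist_of d y (x n))"
  let ?\<psi> = "\<lambda>y. liminf (\<lambda>n. ddist_of d (x n) y)"
  have adj: "left_adjoint_presheaf X d T ?\<phi> ?\<psi>"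
    using x fwd bwd by (rule cauchy_sequence_left_adjoint)
  then obtain u where u: "u \<in> X" "\<And>y. y \<in> X \<Longrightarrow> ?\<phi> y = ddist_of d y u"
    using complete unfolding cauchy_complete_def by blast
  have "?\<phi> u = top"
    using u by (simp add: ddist_of_self)
  moreover have "?\<psi> u = top"
  proof (rule top.extremum_uniqueI)
    have "top \<le> (SUP y\<in>X. ddist_mult T (?\<psi> y) (?\<phi> y))"
      using adj unfolding left_adjoint_presheaf_def ddist_one_eq_top by blast
    also have "\<dots> = (SUP y\<in>X. ddist_mult T (?\<psi> y) (ddist_of d y u))"
      using u by (intro SUP_cong) auto
    also have "\<dots> \<le> ?\<psi> u"
      using adj u(1) unfolding left_adjoint_presheaf_def by (intro SUP_least) blast
    finally show "top \<le> ?\<psi> u" .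
  qed
  ultimately show thesis
    using u(1) that by blast
qed

end

section \<open>The fixpoint theorem\<close>

theorem corollary3p4p1:
  fixes T :: "unit_interval \<Rightarrow> unit_interval \<Rightarrow> unit_interval"
    and X :: "'a set"
    and d :: "'a \<Rightarrow> 'a \<Rightarrow> ennreal \<Rightarrow> unit_interval"
    and \<phi> :: "ddist \<Rightarrow> ddist"
    and f :: "'a \<Rightarrow> 'a"
  assumes "left_continuous_tnorm T"
    and "lower_semicontinuous \<phi>"
    and "\<And>u. bot < u \<Longrightarrow> u < ddist_one \<Longrightarrow> u < \<phi> u"
    and "\<phi> ddist_one = ddist_one"
    and "gen_prob_metric_space X d T"
    and "cauchy_complete X d T"
    and "f \<in> X \<rightarrow> X"
    and "\<And>x y t. x \<in> X \<Longrightarrow> y \<in> X \<Longrightarrow> ddist_fun (\<phi> (ddist_of d x y)) t \<le> d (f x) (f y) t"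
    and "\<exists>x\<in>X. ddist_of d x (f x) \<noteq> bot \<and> ddist_of d (f x) x \<noteq> bot"
  shows "\<exists>u. is_fixpoint X d f u"
proof -
  interpret gen_prob_metric_space X d T
    by fact
  have f: "f y \<in> X" if "y \<in> X" for y
    using assms(7) that by auto
  have contractive: "\<phi> (ddist_of d y z) \<le> ddist_of d (f y) (f z)" if "y \<in> X" "z \<in> X" for y z
    using assms(8) that f by (simp add: less_eq_ddist_def ddist_fun_ddist_of)
  obtain x\<^sub>0 where x\<^sub>0: "x\<^sub>0 \<in> X" "ddist_of d x\<^sub>0 (f x\<^sub>0) \<noteq> bot" "ddist_of d (f x\<^sub>0) x\<^sub>0 \<noteq> bot"
    using assms(9) by blast
  define x where "x n = (f ^^ n) x\<^sub>0" for n
  have x_Suc: "x (Suc n) = f (x n)" for n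
    by (simp add: x_def)
  have x: "x n \<in> X" for n
    by (induction n) (use x\<^sub>0 f in \<open>auto simp: x_def\<close>)
  define D where "D n m = ddist_of d (x n) (x m)" for n m
  interpret D: contractive_kernel "ddist_mult T" \<phi> D
  proof unfold_locales
    show "\<phi> (D n m) \<le> D (Suc n) (Suc m)" for n m
      unfolding D_def x_Suc using x by (intro contractive)
    show "ddist_mult T (D i j) (D j k) \<le> D i k" for i j k
      unfolding D_def using x by (intro ddist_of_triangle)
    show "D 0 1 \<noteq> bot" "D 1 0 \<noteq> bot"
      using x\<^sub>0 by (simp_all add: D_def x_def)
  qed (use assms(2-4) x in \<open>simp_all add: D_def ddist_of_self ddist_one_eq_top\<close>)
  interpret op: contractive_kernel "ddist_mult T" \<phi> "\<lambda>n m. D m n"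
    by (rule D.transpose)
  have "liminf (\<lambda>n. liminf (D n)) = top"
    by (rule ddist_eq_topI) (rule D.totally_below_le_liminf)
  moreover have "liminf (\<lambda>n. liminf (\<lambda>m. D m n)) = top"
    by (rule ddist_eq_topI) (rule op.totally_below_le_liminf)
  ultimately obtain u where u: "u \<in> X"
    and to_orbit: "liminf (\<lambda>n. ddist_of d u (x n)) = top"
    and from_orbit: "liminf (\<lambda>n. ddist_of d (x n) u) = top"
    using cauchy_sequence_limit[of x, OF assms(6) x] unfolding D_def by blast
  have image_to_orbit: "liminf (\<lambda>n. ddist_of d (f u) (x n)) = top"
  proof (rule top.extremum_uniqueI)
    have "top = \<phi> (liminf (\<lambda>n. ddist_of d u (x n)))"
      using to_orbit assms(4) by (simp add: ddist_one_eq_top)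
    also have "\<dots> \<le> liminf (\<lambda>n. \<phi> (ddist_of d u (x n)))"
      by (rule lower_semicontinuous_liminf[OF assms(2)])
    also have "\<dots> \<le> liminf (\<lambda>n. ddist_of d (f u) (x (Suc n)))"
      unfolding x_Suc using u x by (intro liminf_pointwise_mono contractive)
    also have "\<dots> \<le> liminf (\<lambda>n. ddist_of d (f u) (x n))"
      by (rule liminf_Suc_le)
    finally show "top \<le> liminf (\<lambda>n. ddist_of d (f u) (x n))" .
  qed
  have image_from_orbit: "liminf (\<lambda>n. ddist_of d (x n) (f u)) = top"
  proof (rule top.extremum_uniqueI)
    have "top = \<phi> (liminf (\<lambda>n. ddist_of d (x n) u))"
      using from_orbit assms(4) by (simp add: ddist_one_eq_top)
    also have "\<dots> \<le> liminf (\<lambda>n. \<phi> (ddist_of d (x n) u))"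
      by (rule lower_semicontinuous_liminf[OF assms(2)])
    also have "\<dots> \<le> liminf (\<lambda>n. ddist_of d (x (Suc n)) (f u))"
      unfolding x_Suc using u x by (intro liminf_pointwise_mono contractive)
    also have "\<dots> \<le> liminf (\<lambda>n. ddist_of d (x n) (f u))"
      by (rule liminf_Suc_le)
    finally show "top \<le> liminf (\<lambda>n. ddist_of d (x n) (f u))" .
  qed
  have "top \<le> ddist_of d (f u) u"
    using liminf_triangle[of x "f u" u] x u f image_to_orbit from_orbit by (simp add: ddist.mult_top)
  moreover have "top \<le> ddist_of d u (f u)"
    using liminf_triangle[of x u "f u"] x u f to_orbit image_from_orbit by (simp add: ddist.mult_top)
  ultimately show ?thesis
    using u by (auto simp: is_fixpoint_def ddist_one_eq_top top.extremum_unique)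
qed

end
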